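(* Let $X\subset\mathbb{R}$ be a Lusin set and let $Y\subset\mathbb{R}$ be a $\gamma$-set. Then $X\times Y$ has the Rothberger property $\mathsf{S}_1(\mathcal{O},\mathcal{O})$.
   Context: Sets of reals carry the subspace topology from $\mathbb{R}$, and $X\times Y$ carries the product topology. A set of real numbers is a Lusin set if it is uncountable but its intersection with each nowhere dense set (in $\mathbb{R}$) is countable. For a space $Z$: $\mathcal{O}$ is the collection of all open covers of $Z$. An open cover $\mathcal{U}$ of $Z$ is an $\omega$-cover if $Z\notin\mathcal{U}$ and for each finite $F\subset Z$ there is $U\in\mathcal{U}$ with $F\subset U$; $\Omega$ is the collection of $\omega$-covers of $Z$. An open cover $\mathcal{U}$ of $Z$ is a $\gamma$-cover if it is infinite and each infinite subset of it is a cover of $Z$; $\Gamma$ is the collection of $\gamma$-covers of $Z$. For collections $\mathcal{A},\mathcal{B}$ of open covers of $Z$, $\mathsf{S}_1(\mathcal{A},\mathcal{B})$ states: for each sequence $(O_m:m<\infty)$ of elements of $\mathcal{A}$ there is a sequence $(T_m:m<\infty)$ with each $T_m\in O_m$, and $\{T_m:m<\infty\}\in\mathcal{B}$. A set of real numbers is a $\gamma$-set if it has the property $\mathsf{S}_1(\Omega,\Gamma)$. The Rothberger property is $\mathsf{S}_1(\mathcal{O},\mathcal{O})$. *)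

theory Defs
  imports "HOL-Analysis.Analysis"
begin

definition nowhere_dense :: "'a::topological_space set \<Rightarrow> bool" where
  "nowhere_dense N \<longleftrightarrow> interior (closure N) = {}"

definition Lusin_set :: "real set \<Rightarrow> bool" where
  "Lusin_set X \<longleftrightarrow> uncountable X \<and> (\<forall>N. nowhere_dense N \<longrightarrow> countable (X \<inter> N))"

text \<open>Covers of a space consist of open subsets of that space. A cover is required to be a nonempty
  family. This is automatic unless the space is empty; there it excludes the empty cover, from which
  nothing could be selected, so that the empty space has the Rothberger property.\<close>

definition open_covers :: "'a topology \<Rightarrow> 'a set set set" where
  "open_covers Z = {\<U>. \<U> \<noteq> {} \<and> (\<forall>U\<in>\<U>. openin Z U) \<and> \<Union>\<U> = topspace Z}"

definition omega_covers :: "'a topology \<Rightarrow> 'a set set set" where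
  "omega_covers Z = {\<U> \<in> open_covers Z. topspace Z \<notin> \<U> \<and>
     (\<forall>F. finite F \<and> F \<subseteq> topspace Z \<longrightarrow> (\<exists>U\<in>\<U>. F \<subseteq> U))}"

definition gamma_covers :: "'a topology \<Rightarrow> 'a set set set" where
  "gamma_covers Z = {\<U> \<in> open_covers Z. infinite \<U> \<and>
     (\<forall>\<V>. \<V> \<subseteq> \<U> \<and> infinite \<V> \<longrightarrow> \<Union>\<V> = topspace Z)}"

definition S1 :: "'a set set set \<Rightarrow> 'a set set set \<Rightarrow> bool" where
  "S1 \<A> \<B> \<longleftrightarrow> (\<forall>C :: nat \<Rightarrow> 'a set set. (\<forall>m. C m \<in> \<A>) \<longrightarrow>
     (\<exists>T :: nat \<Rightarrow> 'a set. (\<forall>m. T m \<in> C m) \<and> range T \<in> \<B>))"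

definition gamma_set :: "real set \<Rightarrow> bool" where
  "gamma_set Y \<longleftrightarrow> S1 (omega_covers (top_of_set Y)) (gamma_covers (top_of_set Y))"

definition Rothberger :: "'a topology \<Rightarrow> bool" where
  "Rothberger Z \<longleftrightarrow> S1 (open_covers Z) (open_covers Z)"

end

theory Submission
  imports Defs
begin

text \<open>
  The idea is to cover \<open>X \<times> Y\<close> column by column, but to cover along with the columns over a countable
  dense set \<open>D \<subseteq> X\<close> all but countably many of the other columns.

  Let a sequence of covers be given and split it into infinitely many infinite blocks. Let \<open>d\<^sub>m\<close>
  run through \<open>D\<close>, taking each value infinitely often. A single block suffices to cover a box
  \<open>I \<times> V\<close> with \<open>d\<^sub>m \<in> I\<close>, where \<open>V\<close> contains a prescribed finite subset of \<open>Y\<close>. Hence the sets \<open>V\<close>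
  that occur for the block \<open>m\<close> form an \<open>\<omega>\<close>-cover of \<open>Y\<close>, and as \<open>Y\<close> is a \<open>\<gamma>\<close>-set the
  boxes \<open>I\<^sub>m \<times> V\<^sub>m\<close> can be chosen such that each \<open>y \<in> Y\<close> lies in all but finitely many \<open>V\<^sub>m\<close>
  (\<open>gamma_space_select\<close>). If \<open>x\<close> lies in infinitely many \<open>I\<^sub>m\<close>, then for each \<open>y\<close> some \<open>m\<close> has
  \<open>(x, y) \<in> I\<^sub>m \<times> V\<^sub>m\<close>, so the whole column over \<open>x\<close> is covered (\<open>select_columns\<close>).

  The points in infinitely many \<open>I\<^sub>m\<close> form a \<open>G\<^sub>\<delta>\<close> set that contains the dense set \<open>D\<close>. Its
  complement in \<open>X\<close> is meager, and therefore countable, because \<open>X\<close> is a Lusin set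
  (\<open>Lusin_set_countable_Diff\<close>). If only every other cover has been spent so far, the remaining
  covers can be used in the same way to cover the countably many columns that are left.
\<close>

section \<open>Pointwise eventual selection in \<open>\<gamma>\<close>-spaces\<close>

text \<open>
  Two features of the definition of a \<open>\<gamma>\<close>-cover have to be overcome. It speaks of the set of the
  selected sets, so one of them could be selected infinitely often; hence a member of all of
  \<open>W 0, \<dots>, W m\<close> is selected at stage \<open>m\<close>, and then only stages with distinct results are kept, each
  of which serves the earlier stages that were dropped. And an \<open>\<omega>\<close>-cover must not contain the
  whole space. If the space is infinite and \<open>T\<^sub>1\<close>, the whole space can be removed from the family, as
  complements of points remain; if it is finite, the whole space can be selected every time.
\<close>

lemma gamma_space_select:
  fixes Y :: "'a topology" and W :: "nat \<Rightarrow> 'a set set"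
  assumes gamma: "S1 (omega_covers Y) (gamma_covers Y)"
    and t1: "t1_space Y"
    and W_open: "\<And>m V. V \<in> W m \<Longrightarrow> openin Y V"
    and W_down: "\<And>m V V'. V \<in> W m \<Longrightarrow> openin Y V' \<Longrightarrow> V' \<subseteq> V \<Longrightarrow> V' \<in> W m"
    and W_fin: "\<And>m F. finite F \<Longrightarrow> F \<subseteq> topspace Y \<Longrightarrow> \<exists>V\<in>W m. F \<subseteq> V"
  obtains V where "\<And>m. V m \<in> W m"
    and "\<And>y. y \<in> topspace Y \<Longrightarrow> \<forall>\<^sub>F m in sequentially. y \<in> V m"
proof (cases "finite (topspace Y)")
  case True
  have "topspace Y \<in> W m" for m
    using W_fin[OF True, of m] W_open openin_subset by (metis order_refl subset_antisym)
  then show ?thesis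
    by (intro that[of "\<lambda>_. topspace Y"]) auto
next
  case False
  define W' where "W' m = (\<Inter>i\<le>m. W i) - {topspace Y}" for m
  have W'_fin: "\<exists>V\<in>W' m. F \<subseteq> V" if F: "finite F" "F \<subseteq> topspace Y" for m F
  proof -
    obtain y where y: "y \<in> topspace Y" "y \<notin> F"
      using False F by (metis finite_subset subsetI)
    have "\<forall>i. \<exists>V. V \<in> W i \<and> F \<subseteq> V"
      using W_fin F by blast
    then obtain V where V: "\<And>i. V i \<in> W i" "\<And>i. F \<subseteq> V i"
      by metis
    define U where "U = (\<Inter>i\<le>m. V i) - {y}"
    have "openin Y (\<Inter>i\<le>m. V i)"
      by (intro openin_INT2) (auto intro: W_open V)
    moreover have "closedin Y {y}"
      using t1 y by (simp add: t1_space_closedin_singleton)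
    ultimately have "openin Y U"
      unfolding U_def by (rule openin_diff)
    moreover have "U \<subseteq> V i" if "i \<le> m" for i
      using that by (auto simp: U_def)
    ultimately have "U \<in> (\<Inter>i\<le>m. W i)"
      using W_down[OF V(1)] by blast
    then show ?thesis
      using V y by (intro bexI[of _ U]) (auto simp: W'_def U_def)
  qed
  have "W' m \<in> omega_covers Y" for m
  proof -
    have "W' m \<noteq> {}"
      using W'_fin[of "{}" m] by auto
    moreover have op: "\<forall>U\<in>W' m. openin Y U"
      using W_open by (auto simp: W'_def)
    moreover have "\<Union>(W' m) = topspace Y"
    proof
      show "\<Union>(W' m) \<subseteq> topspace Y"
        using op openin_subset by blast
      show "topspace Y \<subseteq> \<Union>(W' m)"
        using W'_fin[of "{y}" m for y] by blast
    qed
    ultimately show ?thesis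
      using W'_fin by (auto simp: omega_covers_def open_covers_def W'_def)
  qed
  then obtain T where T: "\<And>m. T m \<in> W' m" "range T \<in> gamma_covers Y"
    using gamma unfolding S1_def by metis
  have inf: "infinite (range T)"
    and cover: "\<And>\<V>. \<V> \<subseteq> range T \<Longrightarrow> infinite \<V> \<Longrightarrow> \<Union>\<V> = topspace Y"
    using T(2) by (auto simp: gamma_covers_def)
  \<comment> \<open>one stage for each set that is selected\<close>
  define J where "J = inv T ` range T"
  have inj: "inj_on T J"
    unfolding J_def by (auto simp: inj_on_def f_inv_into_f)
  have "T ` J = range T"
    unfolding J_def by (force simp: f_inv_into_f image_iff)
  then have "infinite J"
    using inf by (metis finite_imageI)
  then have "\<forall>m. \<exists>j\<ge>m. j \<in> J"
    by (meson infinite_nat_iff_unbounded_le)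
  then obtain g where g: "\<And>m. m \<le> g m" "\<And>m. g m \<in> J"
    by metis
  show ?thesis
  proof
    show "T (g m) \<in> W m" for m
      using T(1)[of "g m"] g(1)[of m] by (auto simp: W'_def)
    show "\<forall>\<^sub>F m in sequentially. y \<in> T (g m)" if y: "y \<in> topspace Y" for y
    proof -
      let ?B = "{j \<in> J. y \<notin> T j}"
      have "finite (T ` ?B)"
        using cover[of "T ` ?B"] y by auto
      moreover have "inj_on T ?B"
        using inj by (rule inj_on_subset) auto
      ultimately have "finite ?B"
        by (rule finite_imageD)
      then obtain N where "\<And>j. j \<in> ?B \<Longrightarrow> j < N"
        using finite_nat_set_iff_bounded by auto
      then have "y \<in> T (g m)" if "m \<ge> N" for m
        using g[of m] that by (metis (mono_tags, lifting) leD le_trans mem_Collect_eq)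
      then show ?thesis
        using eventually_sequentially by blast
    qed
  qed
qed

section \<open>Covering columns of a product\<close>

text \<open>
  The construction spends one cover on each point of \<open>F\<close>, and the size of \<open>F\<close> is not bounded in
  advance. This is why an infinite block of covers is reserved for each box.
\<close>

lemma select_box:
  fixes U :: "nat \<Rightarrow> ('a \<times> 'b) set set"
  assumes U: "\<And>i. U i \<in> open_covers (prod_topology X Y)"
    and x: "x \<in> topspace X" and F: "finite F" "F \<subseteq> topspace Y"
  obtains T I V where "\<And>i. T i \<in> U i" "openin X I" "x \<in> I" "openin Y V" "F \<subseteq> V"
    "I \<times> V \<subseteq> \<Union>(range T)"
proof -
  obtain f :: "'b \<Rightarrow> nat" where f: "inj_on f F"
    using finite_imp_inj_to_nat_seg[OF F(1)] by blast
  have "\<exists>S\<in>U i. \<forall>y\<in>F. f y = i \<longrightarrow> (x, y) \<in> S" for i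
  proof (cases "i \<in> f ` F")
    case True
    then obtain y where y: "y \<in> F" "i = f y"
      by blast
    have "(x, y) \<in> \<Union>(U i)"
      using U[of i] x y F by (auto simp: open_covers_def)
    then show ?thesis
      using f y by (auto simp: inj_on_def)
  next
    case False
    then show ?thesis
      using U[of i] by (auto simp: open_covers_def)
  qed
  then obtain T where T: "\<And>i. T i \<in> U i" "\<And>y. y \<in> F \<Longrightarrow> (x, y) \<in> T (f y)"
    by metis
  have "\<exists>A B. openin X A \<and> openin Y B \<and> x \<in> A \<and> y \<in> B \<and> A \<times> B \<subseteq> T (f y)" if "y \<in> F" for y
  proof -
    have "openin (prod_topology X Y) (T (f y))"
      using U[of "f y"] T(1)[of "f y"] by (auto simp: open_covers_def)
    then show ?thesis
      using T(2)[OF that] by (auto simp: openin_prod_topology_alt)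
  qed
  then obtain A B where AB: "\<And>y. y \<in> F \<Longrightarrow> openin X (A y)" "\<And>y. y \<in> F \<Longrightarrow> openin Y (B y)"
    "\<And>y. y \<in> F \<Longrightarrow> x \<in> A y" "\<And>y. y \<in> F \<Longrightarrow> y \<in> B y"
    "\<And>y. y \<in> F \<Longrightarrow> A y \<times> B y \<subseteq> T (f y)"
    by metis
  show ?thesis
  proof
    show "T i \<in> U i" for i by (rule T)
    show "openin X (topspace X \<inter> (\<Inter>y\<in>F. A y))"
      using F(1) AB(1) by (cases "F = {}") (auto intro!: openin_Int)
    show "x \<in> topspace X \<inter> (\<Inter>y\<in>F. A y)"
      using x AB by auto
    show "openin Y (\<Union>y\<in>F. B y)"
      using AB by auto
    show "F \<subseteq> (\<Union>y\<in>F. B y)"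
      using AB by auto
    show "(topspace X \<inter> (\<Inter>y\<in>F. A y)) \<times> (\<Union>y\<in>F. B y) \<subseteq> \<Union>(range T)"
      using AB(5) by blast
  qed
qed

text \<open>
  The columns over a countable set can be covered by a selection that covers a whole \<open>G\<^sub>\<delta>\<close> set of
  columns: all those over points that lie in infinitely many of the selected boxes.
\<close>

lemma select_columns:
  fixes U :: "nat \<Rightarrow> ('a \<times> 'b) set set"
  assumes gamma: "S1 (omega_covers Y) (gamma_covers Y)"
    and t1: "t1_space Y"
    and U: "\<And>n. U n \<in> open_covers (prod_topology X Y)"
    and C: "countable C" "C \<subseteq> topspace X"
  obtains T G where "\<And>n. T n \<in> U n" "\<And>k::nat. openin X (G k)" "\<And>k. C \<subseteq> G k"
    "(\<Inter>k. G k) \<times> topspace Y \<subseteq> \<Union>(range T)"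
proof (cases "C = {}")
  case True
  have "U n \<noteq> {}" for n
    using U[of n] by (simp add: open_covers_def)
  then have "\<forall>n. \<exists>S. S \<in> U n"
    by blast
  then obtain T where "\<And>n. T n \<in> U n"
    by metis
  then show ?thesis
    using True by (intro that[of T "\<lambda>_. {}"]) auto
next
  case False
  \<comment> \<open>This sequence takes each value in \<open>C\<close> infinitely often.\<close>
  define d where "d m = from_nat_into C (fst (prod_decode m))" for m
  have d: "d m \<in> topspace X" for m
    using from_nat_into[OF False] C(2) by (auto simp: d_def)
  define box where "box m T I V \<longleftrightarrow> (\<forall>i. T i \<in> U (prod_encode (m, i))) \<and> openin X I \<and> d m \<in> I \<and>
      I \<times> V \<subseteq> \<Union>(range T)" for m T I V
  define W where "W m = {V. openin Y V \<and> (\<exists>T I. box m T I V)}" for m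
  obtain V where V: "\<And>m. V m \<in> W m"
    and V_ev: "\<And>y. y \<in> topspace Y \<Longrightarrow> \<forall>\<^sub>F m in sequentially. y \<in> V m"
  proof (rule gamma_space_select[OF gamma t1, of W])
    show "openin Y V" if "V \<in> W m" for V m
      using that by (simp add: W_def)
    show "V' \<in> W m" if "V \<in> W m" "openin Y V'" "V' \<subseteq> V" for m V V'
      using that unfolding W_def box_def by blast
    show "\<exists>V\<in>W m. F \<subseteq> V" if F: "finite F" "F \<subseteq> topspace Y" for m F
    proof -
      obtain T I V where "\<And>i. T i \<in> U (prod_encode (m, i))" "openin X I" "d m \<in> I" "openin Y V"
        "F \<subseteq> V" "I \<times> V \<subseteq> \<Union>(range T)"
        using select_box[of "\<lambda>i. U (prod_encode (m, i))", OF U d F] by metis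
      then show ?thesis
        unfolding W_def box_def by blast
    qed
  qed blast
  have "\<forall>m. \<exists>T I. box m T I (V m)"
    using V by (auto simp: W_def)
  then obtain T I where box: "\<And>m. box m (T m) (I m) (V m)"
    by metis
  define S where "S n = (case prod_decode n of (m, i) \<Rightarrow> T m i)" for n
  have S_T: "S (prod_encode (m, i)) = T m i" for m i
    by (simp add: S_def)
  show ?thesis
  proof
    show "S n \<in> U n" for n
    proof -
      obtain m i where "n = prod_encode (m, i)"
        by (metis prod_decode_inverse surj_pair)
      then show ?thesis
        using box by (auto simp: S_T box_def)
    qed
    show "openin X (\<Union>m\<in>{k..}. I m)" for k
      using box by (auto simp: box_def)
    show "C \<subseteq> (\<Union>m\<in>{k..}. I m)" for k
    proof
      fix c assume "c \<in> C"
      then obtain l where "c = from_nat_into C l"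
        using C(1) by (metis from_nat_into_surj)
      then have "c = d (prod_encode (l, k))"
        by (simp add: d_def)
      then have "c \<in> I (prod_encode (l, k))"
        using box by (auto simp: box_def)
      then show "c \<in> (\<Union>m\<in>{k..}. I m)"
        using le_prod_encode_2 by blast
    qed
    show "(\<Inter>k. \<Union>m\<in>{k..}. I m) \<times> topspace Y \<subseteq> \<Union>(range S)"
    proof clarify
      fix x y assume x: "x \<in> (\<Inter>k. \<Union>m\<in>{k..}. I m)" and "y \<in> topspace Y"
      then obtain N where N: "\<And>m. m \<ge> N \<Longrightarrow> y \<in> V m"
        using V_ev eventually_sequentially by metis
      obtain m where "m \<ge> N" "x \<in> I m"
        using x by auto
      then have "(x, y) \<in> \<Union>(range (T m))"
        using N box unfolding box_def by blast
      then obtain i where "(x, y) \<in> S (prod_encode (m, i))"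
        by (auto simp: S_T)
      then show "(x, y) \<in> \<Union>(range S)"
        by blast
    qed
  qed
qed

section \<open>Lusin sets and their products with \<open>\<gamma>\<close>-sets\<close>

text \<open>
  Each \<open>X - G k\<close> is nowhere dense: its closure lies in the closure of \<open>D\<close>, so a nonempty open set
  inside it would contain points of \<open>D\<close>, but \<open>D\<close> has the neighbourhood \<open>G k\<close> in \<open>X\<close>.
\<close>

lemma Lusin_set_countable_Diff:
  assumes X: "Lusin_set X"
    and G: "\<And>k::nat. openin (top_of_set X) (G k)" "\<And>k. D \<subseteq> G k"
    and D: "X \<subseteq> closure D"
  shows "countable (X - (\<Inter>k. G k))"
proof -
  have "countable (X - G k)" for k
  proof -
    obtain P where P: "open P" "G k = X \<inter> P"
      using G(1)[of k] openin_open by blast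
    have sub: "closure (X - G k) \<subseteq> - P"
      using P by (intro closure_minimal) auto
    have "closure (X - G k) \<subseteq> closure D"
      using D by (intro closure_minimal) auto
    then have "interior (closure (X - G k)) \<inter> closure D = interior (closure (X - G k))"
      using interior_subset by blast
    moreover have "interior (closure (X - G k)) \<inter> D = {}"
      using sub G(2)[of k] P(2) interior_subset by blast
    ultimately have "interior (closure (X - G k)) = {}"
      using open_Int_closure_eq_empty[OF open_interior] by blast
    then have "countable (X \<inter> (X - G k))"
      using X by (simp add: Lusin_set_def nowhere_dense_def)
    moreover have "X \<inter> (X - G k) = X - G k"
      by blast
    ultimately show ?thesis
      by simp
  qed
  then have "countable (\<Union>k. X - G k)"
    by (intro countable_UN) auto
  then show ?thesis
    by simp
qed

theorem corollary13:
  fixes X Y :: "real set"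
  assumes "Lusin_set X" and "gamma_set Y"
  shows "Rothberger (prod_topology (top_of_set X) (top_of_set Y))"
  unfolding Rothberger_def S1_def
proof (intro allI impI)
  let ?Z = "prod_topology (top_of_set X) (top_of_set Y)"
  fix U :: "nat \<Rightarrow> (real \<times> real) set set"
  assume "\<forall>n. U n \<in> open_covers ?Z"
  then have U: "U n \<in> open_covers ?Z" for n
    by blast
  have gamma: "S1 (omega_covers (top_of_set Y)) (gamma_covers (top_of_set Y))"
    using assms(2) by (simp add: gamma_set_def)
  have t1: "t1_space (top_of_set Y)"
    by (intro t1_space_subtopology) (simp add: Hausdorff_imp_t1_space)
  obtain D where D: "countable D" "D \<subseteq> X" "X \<subseteq> closure D"
    using separable[of X] by blast
  obtain T G where T: "\<And>n. T n \<in> U (2 * n)" and G: "\<And>k::nat. openin (top_of_set X) (G k)"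
    "\<And>k. D \<subseteq> G k" and TG: "(\<Inter>k. G k) \<times> Y \<subseteq> \<Union>(range T)"
    by (rule select_columns[OF gamma t1, of "\<lambda>n. U (2 * n)" "top_of_set X" D])
      (simp_all only: U D topspace_euclidean_subtopology, rule that)
  have rest: "countable (X - (\<Inter>k. G k))"
    using Lusin_set_countable_Diff[OF assms(1) G D(3)] .
  obtain S H where S: "\<And>n. S n \<in> U (2 * n + 1)"
    and H: "\<And>k::nat. X - (\<Inter>k. G k) \<subseteq> H k" and SH: "(\<Inter>k. H k) \<times> Y \<subseteq> \<Union>(range S)"
    by (rule select_columns[OF gamma t1, of "\<lambda>n. U (2 * n + 1)" "top_of_set X" "X - (\<Inter>k. G k)"])
      (simp_all only: U rest Diff_subset topspace_euclidean_subtopology, rule that)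
  define R where "R n = (if even n then T (n div 2) else S (n div 2))" for n
  have R: "R n \<in> U n" for n
    using T[of "n div 2"] S[of "n div 2"] by (cases "even n") (auto simp: R_def)
  have "R (2 * n) = T n" "R (2 * n + 1) = S n" for n
    by (auto simp: R_def)
  then have "\<Union>(range T) \<subseteq> \<Union>(range R)" "\<Union>(range S) \<subseteq> \<Union>(range R)"
    by (metis Sup_subset_mono image_subsetI rangeI)+
  moreover have "X \<times> Y \<subseteq> ((\<Inter>k. G k) \<times> Y) \<union> ((\<Inter>k. H k) \<times> Y)"
    using H by blast
  ultimately have "X \<times> Y \<subseteq> \<Union>(range R)"
    using TG SH by (meson Un_least order_trans)
  then have "topspace ?Z \<subseteq> \<Union>(range R)"
    by simp
  moreover have "openin ?Z (R n)" for n
    using U[of n] R[of n] by (auto simp: open_covers_def)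
  ultimately have "range R \<in> open_covers ?Z"
    using openin_subset by (fastforce simp: open_covers_def)
  with R show "\<exists>R. (\<forall>n. R n \<in> U n) \<and> range R \<in> open_covers ?Z"
    by blast
qed

end
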